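(* The Yao-Yao graph $YY_5$ is not a spanner: for every real number $t\geq 1$ there exist a finite set $S$ of points in the Euclidean plane, an admissible ordering $\prec$ of the pairs of points of $S$, and distinct points $a,b\in S$ such that the Yao-Yao graph $YY_5$ on $S$ satisfies $d_{YY_5}(a,b) > t\,\|ab\|$.
   Context: $\|ab\|$ denotes Euclidean distance. Let $S$ be a finite set of points in the plane. An admissible ordering $\prec$ is a strict total order on the unordered pairs $\{a,b\}$ of distinct points of $S$ such that $\|ab\|<\|cd\|$ implies $\{a,b\}\prec\{c,d\}$ (ties in distance are broken arbitrarily). Cones: for each point $p$, the plane around $p$ is partitioned into five cones $C_1^p,\dots,C_5^p$ with apex $p$, each of angle $2\pi/5$, labelled counterclockwise, where $C_i^p$ consists of the points $q\neq p$ such that the direction of $\overrightarrow{pq}$, measured counterclockwise from the positive $x$-axis, lies in $[2\pi(i-1)/5,\,2\pi i/5)$. The orientation is the same for all points. Directed Yao graph $\overrightarrow{Y_5}$: for each $p\in S$ and each $i$ such that $C_i^p$ contains a point of $S$, let $q\in S\cap C_i^p$ be the point for which $\{p,q\}$ is minimal with respect to $\prec$; then the directed edge $(p,q)$ is in $\overrightarrow{Y_5}$. Directed Yao-Yao graph $\overrightarrow{YY_5}$: for each $p\in S$ and each $i$, among all edges $(q,p)$ of $\overrightarrow{Y_5}$ incoming to $p$ with $q\in C_i^p$ (if any), only the one with $\{q,p\}$ minimal with respect to $\prec$ is kept; the edges kept in this way are exactly the edges of $\overrightarrow{YY_5}$. The Yao-Yao graph $YY_5$ is the underlying undirected graph of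 $\overrightarrow{YY_5}$. For a graph $G$ on $S$ whose edges $ab$ have length $\|ab\|$, $d_G(a,b)$ is the minimum total length of a path in $G$ from $a$ to $b$ ($+\infty$ if none exists). *)

theory Defs
  imports "HOL-Analysis.Analysis"
begin

(* The Euclidean plane is the type complex: dist is Euclidean distance there, and
   Arg2pi z, for nonzero z, is the counterclockwise angle in [0, 2*pi) from the positive
   real axis to z. *)

definition pairs :: "complex set \<Rightarrow> complex set set" where
  "pairs S = {{a, b} | a b. a \<in> S \<and> b \<in> S \<and> a \<noteq> b}"

(* (e, f) \<in> r reads: e strictly precedes f. *)
definition admissible_ordering :: "complex set \<Rightarrow> complex set rel \<Rightarrow> bool" where
  "admissible_ordering S r \<longleftrightarrow>
     r \<subseteq> pairs S \<times> pairs S \<and> strict_linear_order_on (pairs S) r \<and>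
     (\<forall>a\<in>S. \<forall>b\<in>S. \<forall>c\<in>S. \<forall>d\<in>S. a \<noteq> b \<longrightarrow> c \<noteq> d \<longrightarrow>
        dist a b < dist c d \<longrightarrow> ({a, b}, {c, d}) \<in> r)"

definition cone :: "nat \<Rightarrow> complex \<Rightarrow> complex set" where
  "cone i p = {q. q \<noteq> p \<and> 2 * pi * (real i - 1) / 5 \<le> Arg2pi (q - p) \<and>
                  Arg2pi (q - p) < 2 * pi * real i / 5}"

definition directed_Y5 :: "complex set \<Rightarrow> complex set rel \<Rightarrow> complex rel" where
  "directed_Y5 S r =
     {(p, q). p \<in> S \<and> (\<exists>i\<in>{1..5}. q \<in> S \<inter> cone i p \<and>
        (\<forall>q' \<in> S \<inter> cone i p. q' \<noteq> q \<longrightarrow> ({p, q}, {p, q'}) \<in> r))}"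

definition directed_YY5 :: "complex set \<Rightarrow> complex set rel \<Rightarrow> complex rel" where
  "directed_YY5 S r =
     {(q, p). (q, p) \<in> directed_Y5 S r \<and> (\<exists>i\<in>{1..5}. q \<in> cone i p \<and>
        (\<forall>q' \<in> cone i p. (q', p) \<in> directed_Y5 S r \<longrightarrow> q' \<noteq> q \<longrightarrow>
           ({q, p}, {q', p}) \<in> r))}"

definition YY5 :: "complex set \<Rightarrow> complex set rel \<Rightarrow> complex set set" where
  "YY5 S r = {{p, q} | p q. (p, q) \<in> directed_YY5 S r}"

definition path_between :: "complex set set \<Rightarrow> complex \<Rightarrow> complex \<Rightarrow> complex list \<Rightarrow> bool" where
  "path_between E a b xs \<longleftrightarrow>
     xs \<noteq> [] \<and> hd xs = a \<and> last xs = b \<and> distinct xs \<and>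
     successively (\<lambda>u v. {u, v} \<in> E) xs"

definition path_length :: "complex list \<Rightarrow> real" where
  "path_length xs = sum_list (map2 dist xs (tl xs))"

(* A finite graph has only finitely many (vertex-repetition-free) paths between two
   vertices, so the infimum is a minimum if there is one, and \<infinity> otherwise. *)
definition graph_dist :: "complex set set \<Rightarrow> complex \<Rightarrow> complex \<Rightarrow> ereal" where
  "graph_dist E a b = (INF xs \<in> {xs. path_between E a b xs}. ereal (path_length xs))"

end

theory Submission
  imports Defs
begin

text \<open>
  Take two almost parallel rows of points, the lower one \<open>p\<^sub>i = (i, 0)\<close> and the upper one
  \<open>q\<^sub>j = (j + 1/2, 1 - j / (10 n))\<close>, for \<open>0 \<le> i, j \<le> n\<close>. Steps within a row are shorter than
  all distances between the rows. As the upper row descends slightly, the step from \<open>q\<^sub>j\<close> to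
  \<open>q\<^sub>j\<^sub>+\<^sub>1\<close> lies in the fifth cone, together with all \<open>p\<^sub>i\<close>, \<open>i > j\<close>, while the step from \<open>p\<^sub>i\<close>
  to \<open>p\<^sub>i\<^sub>+\<^sub>1\<close> lies in the first cone, together with all \<open>q\<^sub>j\<close>, \<open>j \<ge> i\<close>. So each pair
  \<open>p\<^sub>i, q\<^sub>j\<close> except \<open>p\<^sub>n, q\<^sub>n\<close> has an endpoint at which its edge loses, both as an outgoing and as
  an incoming edge, against the next step in that endpoint's row. Every path from \<open>p\<^sub>0\<close> to \<open>q\<^sub>0\<close>
  therefore visits \<open>p\<^sub>n\<close> and has length at least \<open>n\<close>, although \<open>p\<^sub>0\<close> and \<open>q\<^sub>0\<close> are at distance less than \<open>2\<close>.
\<close>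

subsection \<open>Cones\<close>

text \<open>The double and the triple of \<open>2 * pi / 5\<close> add up to \<open>2 * pi\<close>,
  so their cosines agree. Removing the root 1 leaves \<open>4 * x\<^sup>2 + 2 * x = 1\<close>, whose
  left side is 3/4 at 1/4 and 36/25 at 2/5.\<close>

lemma cos_2pi_5_bounds: "1 / 4 < cos (2 * pi / 5)" "cos (2 * pi / 5) < 2 / 5"
proof -
  define x where "x = cos (2 * pi / 5)"
  have "0 < x"
    unfolding x_def by (rule cos_gt_zero_pi) (use pi_gt_zero in linarith)+
  have "cos (2 * pi / 5) < cos 0"
    by (rule cos_monotone_0_pi) (use pi_gt_zero in linarith)+
  then have "x < 1" by (simp add: x_def)
  have "cos (3 * (2 * pi / 5)) = cos (2 * pi - 2 * (2 * pi / 5))"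
    by (simp add: algebra_simps)
  also have "\<dots> = cos (2 * (2 * pi / 5))"
    unfolding cos_diff by simp
  finally have "4 * x ^ 3 - 3 * x = 2 * x\<^sup>2 - 1"
    unfolding cos_treble_cos cos_double_cos x_def .
  then have "(x - 1) * (4 * x\<^sup>2 + 2 * x - 1) = 0"
    by (simp add: algebra_simps power2_eq_square power3_eq_cube)
  with \<open>x < 1\<close> have root: "4 * x\<^sup>2 + 2 * x = 1" by simp
  have "x < 2 / 5"
  proof (rule ccontr)
    assume "\<not> x < 2 / 5"
    then have "x \<ge> 2 / 5" by simp
    then have "x\<^sup>2 \<ge> (2 / 5)\<^sup>2" by (intro power_mono) auto
    with root \<open>x \<ge> 2 / 5\<close> show False by (simp add: power2_eq_square)
  qed
  then show "cos (2 * pi / 5) < 2 / 5" by (simp add: x_def)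
  have "1 / 4 < x"
  proof (rule ccontr)
    assume "\<not> 1 / 4 < x"
    then have "x \<le> 1 / 4" by simp
    then have "x\<^sup>2 \<le> (1 / 4)\<^sup>2" using \<open>0 < x\<close> by (intro power_mono) auto
    with root \<open>x \<le> 1 / 4\<close> show False by (simp add: power2_eq_square)
  qed
  then show "1 / 4 < cos (2 * pi / 5)" by (simp add: x_def)
qed

text \<open>Slope 2 is a rational bound below tan (2 pi / 5). A cosine below 2/5 would give 25 (Re
  z)^2 < 4 |z|^2 \<le> 20 (Re z)^2.\<close>

lemma Arg2pi_less_2pi_5:
  assumes "0 < Re z" "0 \<le> Im z" "Im z \<le> 2 * Re z"
  shows "Arg2pi z < 2 * pi / 5"
proof (rule ccontr)
  assume "\<not> Arg2pi z < 2 * pi / 5"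
  moreover have "Arg2pi z \<le> pi" using assms(2) Arg2pi_le_pi by blast
  ultimately have "cos (Arg2pi z) \<le> cos (2 * pi / 5)"
    by (intro cos_monotone_0_pi_le) auto
  then have "cos (Arg2pi z) < 2 / 5"
    using cos_2pi_5_bounds(2) by linarith
  moreover have "0 < cmod z" using assms(1) by fastforce
  ultimately have "cmod z * cos (Arg2pi z) < cmod z * (2 / 5)"
    by (intro mult_strict_left_mono)
  then have "5 * Re z < 2 * cmod z" by (simp add: cos_Arg2pi)
  then have "(5 * Re z)\<^sup>2 < (2 * cmod z)\<^sup>2"
    using assms(1) by (intro power_strict_mono) auto
  moreover have "(Im z)\<^sup>2 \<le> (2 * Re z)\<^sup>2"
    using assms by (intro power_mono) auto
  moreover have "(Re z)\<^sup>2 > 0" using assms(1) by simp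
  ultimately show False by (simp add: power_mult_distrib cmod_power2)
qed

lemma in_cone_1:
  assumes "0 < Re (q - p)" "0 \<le> Im (q - p)" "Im (q - p) \<le> 2 * Re (q - p)"
  shows "q \<in> cone 1 p"
  using assms Arg2pi_less_2pi_5[OF assms] Arg2pi_ge_0 by (auto simp: cone_def)

text \<open>Conjugation reduces this to the first cone. Strictness of \<open>Im (q - p) < 0\<close>
  keeps the direction off the positive axis, where \<open>Arg2pi\<close> jumps.\<close>

lemma in_cone_5:
  assumes "0 < Re (q - p)" "Im (q - p) < 0" "- Im (q - p) \<le> 2 * Re (q - p)"
  shows "q \<in> cone 5 p"
proof -
  have "Arg2pi (cnj (q - p)) < 2 * pi / 5"
    by (rule Arg2pi_less_2pi_5) (use assms in auto)
  moreover have "Arg2pi (cnj (q - p)) = 2 * pi - Arg2pi (q - p)"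
    using assms(2) Arg2pi_cnj[of "q - p"] by (auto simp: complex_is_Real_iff)
  ultimately show ?thesis
    using assms(1) Arg2pi_lt_2pi[of "q - p"] by (auto simp: cone_def field_simps)
qed

lemma in_cone_3:
  assumes "Re (q - p) < 0" "0 \<le> Im (q - p)" "2 * Im (q - p) \<le> - Re (q - p)"
  shows "q \<in> cone 3 p"
proof -
  define z where "z = q - p"
  have z: "Re z < 0" "0 \<le> Im z" "2 * Im z \<le> - Re z"
    using assms by (simp_all add: z_def)
  have "Arg2pi z \<le> pi" using z Arg2pi_le_pi by simp
  then have "Arg2pi z < 2 * pi * 3 / 5" using pi_gt_zero by linarith
  moreover have "2 * (2 * pi / 5) \<le> Arg2pi z"
  proof (rule ccontr)
    assume "\<not> 2 * (2 * pi / 5) \<le> Arg2pi z"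
    then have "cos (2 * (2 * pi / 5)) \<le> cos (Arg2pi z)"
      using Arg2pi_ge_0[of z] by (intro cos_monotone_0_pi_le) auto
    \<comment> \<open>The double-angle formula turns 1/4 into the bound -7/8 for cos (4 pi / 5). It
      would force 64 (Re z)^2 < 49 |z|^2, but the slope bound gives |z|^2 \<le> 5/4 (Re
      z)^2.\<close>
    moreover have "(1 / 4)\<^sup>2 < (cos (2 * pi / 5))\<^sup>2"
      using cos_2pi_5_bounds by (intro power_strict_mono) auto
    ultimately have "- (7 / 8) < cos (Arg2pi z)"
      unfolding cos_double_cos by (simp add: power2_eq_square)
    moreover have "0 < cmod z" using z(1) by fastforce
    ultimately have "cmod z * - (7 / 8) < cmod z * cos (Arg2pi z)"
      by (intro mult_strict_left_mono)
    then have "8 * - Re z < 7 * cmod z" by (simp add: cos_Arg2pi)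
    then have "(8 * - Re z)\<^sup>2 < (7 * cmod z)\<^sup>2"
      using z(1) by (intro power_strict_mono) auto
    moreover have "(2 * Im z)\<^sup>2 \<le> (- Re z)\<^sup>2"
      using z by (intro power_mono) auto
    moreover have "(Re z)\<^sup>2 > 0" using z(1) by simp
    ultimately show False by (simp add: power_mult_distrib cmod_power2)
  qed
  ultimately show ?thesis
    using assms(1) by (auto simp: cone_def z_def)
qed

text \<open>The cone is centred on the negative real axis with half-angle pi / 5. Hence only points
  further left compete for the backward edges.\<close>

lemma cone_3_Re_less:
  assumes "q \<in> cone 3 p"
  shows "Re q < Re p"
proof -
  define t where "t = Arg2pi (q - p)"
  have "cos (t - pi) > 0"
    by (rule cos_gt_zero_pi) (use assms pi_gt_zero in \<open>auto simp: cone_def t_def\<close>)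
  then have "cos t < 0" by (simp add: cos_diff)
  moreover have "cmod (q - p) > 0" using assms by (auto simp: cone_def)
  ultimately have "cmod (q - p) * cos t < 0" by (simp add: mult_pos_neg)
  then show ?thesis by (simp add: cos_Arg2pi t_def)
qed

text \<open>Identifies the cone index hidden in a Yao or Yao-Yao edge with the cone at hand.\<close>

lemma cone_unique:
  assumes "q \<in> cone i p" "q \<in> cone j p"
  shows "i = j"
proof -
  have "2 * pi * (real i - 1) / 5 < 2 * pi * real j / 5"
    "2 * pi * (real j - 1) / 5 < 2 * pi * real i / 5"
    using assms unfolding cone_def mem_Collect_eq by linarith+
  then have "real i - 1 < real j" "real j - 1 < real i"
    by (simp_all add: divide_less_cancel)
  then show ?thesis by linarith
qed

subsection \<open>Admissible orderings\<close>

lemma exists_admissible_ordering: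
  assumes "finite S"
  shows "\<exists>r. admissible_ordering S r"
proof -
  \<comment> \<open>The double sum makes length a function of the unordered pair, at the price of a
    factor 2. An injective numbering will break ties.\<close>
  define len :: "complex set \<Rightarrow> real" where "len e = (\<Sum>x\<in>e. \<Sum>y\<in>e. dist x y)" for e
  have len: "len {a, b} = 2 * dist a b" for a b
    by (cases "a = b") (auto simp: len_def dist_commute)
  have "pairs S \<subseteq> Pow S" by (auto simp: pairs_def)
  then have "finite (pairs S)" using assms finite_subset by blast
  then obtain idx :: "complex set \<Rightarrow> nat" where idx: "inj_on idx (pairs S)"
    using finite_imp_inj_to_nat_seg by blast
  define r where "r = {(e, f). e \<in> pairs S \<and> f \<in> pairs S \<and>
      (len e < len f \<or> len e = len f \<and> idx e < idx f)}"
  have "strict_linear_order_on (pairs S) r"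
    unfolding strict_linear_order_on_def
  proof (intro conjI)
    show "trans r" by (auto simp: trans_def r_def)
    show "irrefl r" by (auto simp: irrefl_def r_def)
    show "total_on (pairs S) r"
    proof (rule total_onI)
      fix e f assume ef: "e \<in> pairs S" "f \<in> pairs S" "e \<noteq> f"
      then have "idx e \<noteq> idx f" using idx by (meson inj_onD)
      with ef show "(e, f) \<in> r \<or> (f, e) \<in> r" by (auto simp: r_def)
    qed
  qed
  moreover have "({a, b}, {c, d}) \<in> r"
    if "a \<in> S" "b \<in> S" "c \<in> S" "d \<in> S" "a \<noteq> b" "c \<noteq> d" "dist a b < dist c d" for a b c d
    using that by (auto simp: r_def len pairs_def)
  ultimately have "admissible_ordering S r"
    unfolding admissible_ordering_def by (auto simp: r_def)
  then show ?thesis ..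
qed

lemma admissible_ordering_not_less:
  assumes "admissible_ordering S r" "a \<in> S" "b \<in> S" "c \<in> S" "d \<in> S" "a \<noteq> b" "c \<noteq> d"
    and "dist a b < dist c d"
  shows "({c, d}, {a, b}) \<notin> r"
proof
  assume "({c, d}, {a, b}) \<in> r"
  moreover have "({a, b}, {c, d}) \<in> r"
    using assms unfolding admissible_ordering_def by blast
  moreover have "trans r" "irrefl r"
    using assms(1) unfolding admissible_ordering_def strict_linear_order_on_def by blast+
  ultimately show False by (meson irreflD transD)
qed

section \<open>Distance criteria for Yao and Yao-Yao edges\<close>

lemma directed_Y5_in: "(p, q) \<in> directed_Y5 S r \<Longrightarrow> p \<in> S \<and> q \<in> S"
  by (auto simp: directed_Y5_def)

lemma nearest_in_directed_Y5:
  assumes "admissible_ordering S r" "p \<in> S" "q \<in> S" "q \<in> cone i p" "i \<in> {1..5}"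
    and "\<And>q'. q' \<in> S \<Longrightarrow> q' \<in> cone i p \<Longrightarrow> q' \<noteq> q \<Longrightarrow> dist p q < dist p q'"
  shows "(p, q) \<in> directed_Y5 S r"
proof -
  have "({p, q}, {p, q'}) \<in> r" if "q' \<in> S \<inter> cone i p" "q' \<noteq> q" for q'
  proof -
    have "p \<noteq> q" "p \<noteq> q'" using that assms(4) by (auto simp: cone_def)
    with that assms show ?thesis unfolding admissible_ordering_def by blast
  qed
  with assms(2-5) show ?thesis unfolding directed_Y5_def by blast
qed

lemma not_in_directed_Y5:
  assumes "admissible_ordering S r" "q' \<in> S" "q \<in> cone i p" "q' \<in> cone i p"
    and "dist p q' < dist p q"
  shows "(p, q) \<notin> directed_Y5 S r"
proof
  assume "(p, q) \<in> directed_Y5 S r"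
  then obtain j where "p \<in> S" "q \<in> S" "q \<in> cone j p"
    and less: "\<And>x. x \<in> S \<inter> cone j p \<Longrightarrow> x \<noteq> q \<Longrightarrow> ({p, q}, {p, x}) \<in> r"
    unfolding directed_Y5_def by blast
  have "j = i" using \<open>q \<in> cone j p\<close> assms(3) by (rule cone_unique)
  then have "({p, q}, {p, q'}) \<in> r" using less[of q'] assms by auto
  moreover have "p \<noteq> q" "p \<noteq> q'" using assms(3,4) by (auto simp: cone_def)
  ultimately show False
    using admissible_ordering_not_less[OF assms(1), of p q' p q] assms \<open>p \<in> S\<close> \<open>q \<in> S\<close> by blast
qed

text \<open>The rival has to be a Yao edge into \<open>p\<close>; a closer point alone does not
  exclude \<open>q\<close>. For this reason the backward steps of both rows are shown to be Yao
  edges.\<close>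

lemma not_in_directed_YY5:
  assumes "admissible_ordering S r" "(q', p) \<in> directed_Y5 S r" "q \<in> cone i p" "q' \<in> cone i p"
    and "dist q' p < dist q p"
  shows "(q, p) \<notin> directed_YY5 S r"
proof
  assume "(q, p) \<in> directed_YY5 S r"
  then obtain j where "(q, p) \<in> directed_Y5 S r" "q \<in> cone j p"
    and less: "\<And>x. x \<in> cone j p \<Longrightarrow> (x, p) \<in> directed_Y5 S r \<Longrightarrow> x \<noteq> q \<Longrightarrow> ({q, p}, {x, p}) \<in> r"
    unfolding directed_YY5_def by blast
  have "j = i" using \<open>q \<in> cone j p\<close> assms(3) by (rule cone_unique)
  then have "({q, p}, {q', p}) \<in> r" using less[of q'] assms by auto
  moreover have "q \<noteq> p" "q' \<noteq> p" using assms(3,4) by (auto simp: cone_def)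
  moreover have "p \<in> S" "q \<in> S" "q' \<in> S"
    using directed_Y5_in[OF assms(2)] directed_Y5_in[OF \<open>(q, p) \<in> directed_Y5 S r\<close>] by auto
  ultimately show False
    using admissible_ordering_not_less[OF assms(1), of q' p q p] assms(5) by blast
qed

subsection \<open>Paths\<close>

lemma path_length_nonneg: "0 \<le> path_length xs"
  unfolding path_length_def by (rule sum_list_nonneg) (auto simp: in_set_zip)

lemma dist_hd_le_path_length:
  "x \<in> set xs \<Longrightarrow> dist (hd xs) x \<le> path_length xs"
proof (induction xs rule: induct_list012)
  case (3 y z zs)
  have len: "path_length (y # z # zs) = dist y z + path_length (z # zs)"
    by (simp add: path_length_def)
  show ?case
  proof (cases "x = y")
    case True
    then show ?thesis by (simp add: path_length_nonneg)
  next
    case False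
    with 3 have "dist z x \<le> path_length (z # zs)" by simp
    then show ?thesis using dist_triangle[of y x z] len by simp
  qed
qed (auto simp: path_length_def)

lemma successively_crossing:
  assumes "successively P xs" "xs \<noteq> []" "hd xs \<in> A" "last xs \<notin> A"
  shows "\<exists>u v. u \<in> set xs \<and> u \<in> A \<and> v \<notin> A \<and> P u v"
  using assms
proof (induction xs rule: induct_list012)
  case (3 y z zs)
  then show ?case by (cases "z \<in> A") (auto split: if_splits)
qed auto

text \<open>A path has to leave \<open>A\<close>, hence visits \<open>c\<close>, and the triangle
  inequality bounds its part up to \<open>c\<close>. If no path exists, the infimum is
  infinite.\<close>

lemma graph_dist_ge_cut_vertex:
  assumes "a \<in> A" "b \<notin> A"
    and "\<And>u v. u \<in> A \<Longrightarrow> v \<notin> A \<Longrightarrow> {u, v} \<in> E \<Longrightarrow> u = c"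
  shows "ereal (dist a c) \<le> graph_dist E a b"
  unfolding graph_dist_def
proof (rule INF_greatest)
  fix xs assume "xs \<in> {xs. path_between E a b xs}"
  then have xs: "xs \<noteq> []" "hd xs = a" "last xs = b" "successively (\<lambda>u v. {u, v} \<in> E) xs"
    by (auto simp: path_between_def)
  with assms successively_crossing[of _ xs A] have "c \<in> set xs" by blast
  with dist_hd_le_path_length xs(2) show "ereal (dist a c) \<le> ereal (path_length xs)" by auto
qed

subsection \<open>The two rows\<close>

definition lower :: "nat \<Rightarrow> complex" where
  "lower i = Complex (real i) 0"

text \<open>The shift by 1/2 keeps horizontal gaps between the rows at least 1/2. As heights are at
  most 1, slopes between the rows stay within the bound 2 of the cone tests.\<close>

definition upper :: "nat \<Rightarrow> nat \<Rightarrow> complex" where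
  "upper n j = Complex (real j + 1 / 2) (1 - real j / (10 * real n))"

definition rows :: "nat \<Rightarrow> complex set" where
  "rows n = lower ` {..n} \<union> upper n ` {..n}"

lemma height_bounds:
  assumes "j \<le> n"
  shows "9 / 10 \<le> 1 - real j / (10 * real n)" "1 - real j / (10 * real n) \<le> 1"
  \<comment> \<open>For \<open>n = 0\<close> division by zero yields 0, so the height is 1.\<close>
  using assms by (cases "n = 0"; simp add: field_simps)+

section \<open>Distances between and within the rows\<close>

lemma dist_complex: "dist (Complex a b) (Complex c d) = sqrt ((a - c)\<^sup>2 + (b - d)\<^sup>2)"
  by (simp add: dist_norm complex_norm complex_diff)

text \<open>The horizontal offset is at least 1/2 and the vertical one at least 9/10; their squares
  add up to 106/100.\<close>

lemma dist_lower_upper: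
  assumes "j \<le> n"
  shows "sqrt (106 / 100) \<le> dist (lower i) (upper n j)"
proof -
  have "(1 / 2)\<^sup>2 \<le> (real i - (real j + 1 / 2))\<^sup>2"
  proof (cases "i \<le> j")
    case True
    then have "(1 / 2)\<^sup>2 \<le> ((real j + 1 / 2) - real i)\<^sup>2" by (intro power_mono) auto
    then show ?thesis by (simp add: power2_commute)
  next
    case False
    then have "real i \<ge> real j + 1" by linarith
    then show ?thesis by (intro power_mono) auto
  qed
  moreover have "(9 / 10)\<^sup>2 \<le> (1 - real j / (10 * real n))\<^sup>2"
    using height_bounds[OF assms] by (intro power_mono) auto
  moreover have "(0 - (1 - real j / (10 * real n)))\<^sup>2 = (1 - real j / (10 * real n))\<^sup>2"
    by (simp add: power2_commute)
  moreover have "(1 / 2)\<^sup>2 + (9 / 10)\<^sup>2 = (106 / 100 :: real)"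
    by (simp add: power2_eq_square)
  ultimately show ?thesis
    unfolding lower_def upper_def dist_complex by (intro real_sqrt_le_mono) linarith
qed

lemma dist_lower_Suc: "dist (lower i) (lower (Suc i)) = 1"
  by (simp add: lower_def dist_complex)

lemma upper_step: "upper n (Suc j) - upper n j = Complex 1 (- 1 / (10 * real n))"
  by (simp add: upper_def complex_eq_iff add_divide_distrib)

lemma dist_upper_Suc:
  assumes "n > 0"
  shows "dist (upper n j) (upper n (Suc j)) < sqrt (106 / 100)"
proof -
  \<comment> \<open>One step falls by at most 1/10, so its squared length is at most
    101/100.\<close>
  have "(1 / (10 * real n))\<^sup>2 \<le> (1 / 10)\<^sup>2"
    using assms by (intro power_mono) (auto simp: field_simps)
  then have "sqrt (1 + (1 / (10 * real n))\<^sup>2) < sqrt (106 / 100)"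
    by (intro real_sqrt_less_mono) (simp add: power2_eq_square)
  moreover have "dist (upper n j) (upper n (Suc j)) = sqrt (1 + (1 / (10 * real n))\<^sup>2)"
    using upper_step[of n j]
    by (subst dist_commute) (simp add: dist_norm complex_norm)
  ultimately show ?thesis by simp
qed

section \<open>Yao edges directed backward along the rows\<close>

lemma sqrt_106_100_less_2: "sqrt (106 / 100) < 2"
  by (rule real_less_lsqrt) auto

lemma dist_ge_2:
  assumes "real k + 2 \<le> real i"
  shows "2 \<le> dist (Complex (real i + c) y) (Complex (real k + c) y')"
proof -
  have "2 \<le> \<bar>Re (Complex (real i + c) y - Complex (real k + c) y')\<bar>"
    using assms by simp
  then show ?thesis unfolding dist_norm using abs_Re_le_cmod order_trans by blast
qed

text \<open>Provides the rival of edges entering \<open>lower i\<close> from the upper row. In the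
  third cone, the other lower points are at distance at least 2 and the upper points at distance
  more than 1.\<close>

lemma lower_back_in_Y5:
  assumes "admissible_ordering (rows n) r" "i < n"
  shows "(lower (Suc i), lower i) \<in> directed_Y5 (rows n) r"
proof (rule nearest_in_directed_Y5[OF assms(1), where i = 3])
  show "lower i \<in> cone 3 (lower (Suc i))"
    by (rule in_cone_3) (auto simp: lower_def)
  fix x assume x: "x \<in> rows n" "x \<in> cone 3 (lower (Suc i))" "x \<noteq> lower i"
  have "Re x < real i + 1" using cone_3_Re_less[OF x(2)] by (simp add: lower_def)
  from x(1) consider k where "x = lower k" "k \<le> n" | k where "x = upper n k" "k \<le> n"
    by (auto simp: rows_def)
  then show "dist (lower (Suc i)) (lower i) < dist (lower (Suc i)) x"
  proof cases
    case 1
    with x(3) have "k \<noteq> i" by auto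
    moreover have "k < Suc i" using \<open>Re x < real i + 1\<close> 1 by (simp add: lower_def)
    ultimately have "real k + 2 \<le> real (Suc i)" by linarith
    from dist_ge_2[OF this, of 0 0 0] have "2 \<le> dist (lower (Suc i)) x"
      by (simp add: 1 lower_def)
    then show ?thesis using dist_lower_Suc[of i] by (simp add: dist_commute)
  next
    case 2
    have "1 < sqrt (106 / 100)" by simp
    also have "\<dots> \<le> dist (lower (Suc i)) x"
      unfolding 2(1) by (rule dist_lower_upper[OF 2(2)])
    finally show ?thesis using dist_lower_Suc[of i] by (simp add: dist_commute)
  qed
qed (use assms(2) in \<open>auto simp: rows_def\<close>)

text \<open>This step is slightly longer than 1, so it is compared with
  \<open>sqrt (106 / 100)\<close>, the lower bound for distances between the rows.\<close>

lemma upper_back_in_Y5: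
  assumes "admissible_ordering (rows n) r" "j < n"
  shows "(upper n (Suc j), upper n j) \<in> directed_Y5 (rows n) r"
proof (rule nearest_in_directed_Y5[OF assms(1), where i = 3])
  have "upper n j - upper n (Suc j) = - (upper n (Suc j) - upper n j)" by simp
  then have step: "upper n j - upper n (Suc j) = Complex (- 1) (1 / (10 * real n))"
    unfolding upper_step by (simp add: complex_eq_iff)
  show "upper n j \<in> cone 3 (upper n (Suc j))"
    by (rule in_cone_3; unfold step; use assms(2) in \<open>simp add: field_simps\<close>)
  fix x assume x: "x \<in> rows n" "x \<in> cone 3 (upper n (Suc j))" "x \<noteq> upper n j"
  have "Re x < real j + 3 / 2" using cone_3_Re_less[OF x(2)] by (simp add: upper_def)
  have short: "dist (upper n (Suc j)) (upper n j) < sqrt (106 / 100)"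
    using dist_upper_Suc[of n j] assms(2) by (simp add: dist_commute)
  from x(1) consider k where "x = lower k" "k \<le> n" | k where "x = upper n k" "k \<le> n"
    by (auto simp: rows_def)
  then show "dist (upper n (Suc j)) (upper n j) < dist (upper n (Suc j)) x"
  proof cases
    case 1
    then show ?thesis
      using short dist_lower_upper[of "Suc j" n k] assms(2) by (simp add: dist_commute)
  next
    case 2
    with x(3) have "k \<noteq> j" by auto
    moreover have "k < Suc j" using \<open>Re x < real j + 3 / 2\<close> 2 by (simp add: upper_def)
    ultimately have "real k + 2 \<le> real (Suc j)" by linarith
    then have "2 \<le> dist (upper n (Suc j)) x"
      unfolding 2(1) upper_def by (rule dist_ge_2)
    then show ?thesis using short sqrt_106_100_less_2 by linarith
  qed
qed (use assms(2) in \<open>auto simp: rows_def\<close>)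

section \<open>Cones of forward steps and of edges between the rows\<close>

lemma lower_Suc_in_cone: "lower (Suc i) \<in> cone 1 (lower i)"
  by (rule in_cone_1) (auto simp: lower_def)

lemma upper_in_cone:
  assumes "i \<le> j" "j \<le> n"
  shows "upper n j \<in> cone 1 (lower i)"
proof -
  define h where "h = 1 - real j / (10 * real n)"
  have "9 / 10 \<le> h" "h \<le> 1" using height_bounds[OF assms(2)] by (simp_all only: h_def)
  moreover have "real i \<le> real j" using assms(1) by simp
  ultimately show ?thesis
    by (intro in_cone_1) (auto simp: lower_def upper_def simp flip: h_def)
qed

text \<open>Here the descent of the upper row matters: a level step would fall into the first cone,
  away from the lower points it has to beat.\<close>

lemma upper_Suc_in_cone:
  assumes "n > 0"
  shows "upper n (Suc j) \<in> cone 5 (upper n j)"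
  by (rule in_cone_5; unfold upper_step; use assms in \<open>simp add: field_simps\<close>)

lemma lower_in_cone:
  assumes "j < i" "j \<le> n"
  shows "lower i \<in> cone 5 (upper n j)"
proof -
  have "real j + 1 \<le> real i" using assms(1) by linarith
  moreover define h where "h = 1 - real j / (10 * real n)"
  have "9 / 10 \<le> h" "h \<le> 1" using height_bounds[OF assms(2)] by (simp_all only: h_def)
  ultimately show ?thesis
    by (intro in_cone_5) (auto simp: lower_def upper_def simp flip: h_def)
qed

lemma crossing_edge_YY5_rows:
  assumes adm: "admissible_ordering (rows n) r" and "i \<le> n" "j \<le> n"
    and edge: "{lower i, upper n j} \<in> YY5 (rows n) r"
  shows "i = n"
proof (rule ccontr)
  assume "i \<noteq> n"
  with assms(2) have "i < n" by simp
  have rung: "sqrt (106 / 100) \<le> dist (lower i) (upper n j)"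
    using dist_lower_upper[OF assms(3)] .
  have "(1::real) < sqrt (106 / 100)" by simp
  have "(lower i, upper n j) \<notin> directed_YY5 (rows n) r \<and>
        (upper n j, lower i) \<notin> directed_YY5 (rows n) r"
  \<comment> \<open>The endpoint further left decides: \<open>lower i\<close> if
    \<open>i \<le> j\<close>, otherwise \<open>upper n j\<close>. There the edge loses as outgoing
    edge to the forward step and as incoming edge to the backward step.\<close>
  proof (cases "i \<le> j")
    case True
    have cones: "upper n j \<in> cone 1 (lower i)" "lower (Suc i) \<in> cone 1 (lower i)"
      using upper_in_cone[OF True assms(3)] lower_Suc_in_cone .
    have less: "dist (lower i) (lower (Suc i)) < dist (lower i) (upper n j)"
      using dist_lower_Suc[of i] rung \<open>1 < sqrt (106 / 100)\<close> by linarith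
    have "lower (Suc i) \<in> rows n" using \<open>i < n\<close> by (auto simp: rows_def)
    from not_in_directed_Y5[OF adm this cones less]
    have "(lower i, upper n j) \<notin> directed_Y5 (rows n) r" .
    moreover have "(upper n j, lower i) \<notin> directed_YY5 (rows n) r"
      using not_in_directed_YY5[OF adm lower_back_in_Y5[OF adm \<open>i < n\<close>] cones] less
      by (simp add: dist_commute)
    ultimately show ?thesis by (auto simp: directed_YY5_def)
  next
    case False
    \<comment> \<open>\<open>j < n\<close> guarantees that the upper row has a next point.\<close>
    then have "j < i" "j < n" using \<open>i < n\<close> by auto
    have cones: "lower i \<in> cone 5 (upper n j)" "upper n (Suc j) \<in> cone 5 (upper n j)"
      using lower_in_cone[OF \<open>j < i\<close> assms(3)] upper_Suc_in_cone \<open>j < n\<close> by auto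
    have less: "dist (upper n j) (upper n (Suc j)) < dist (upper n j) (lower i)"
      using dist_upper_Suc[of n j] \<open>j < n\<close> rung by (simp add: dist_commute)
    have "upper n (Suc j) \<in> rows n" using \<open>j < n\<close> by (auto simp: rows_def)
    from not_in_directed_Y5[OF adm this cones less]
    have "(upper n j, lower i) \<notin> directed_Y5 (rows n) r" .
    moreover have "(lower i, upper n j) \<notin> directed_YY5 (rows n) r"
      using not_in_directed_YY5[OF adm upper_back_in_Y5[OF adm \<open>j < n\<close>] cones] less
      by (simp add: dist_commute)
    ultimately show ?thesis by (auto simp: directed_YY5_def)
  qed
  with edge show False by (auto simp: YY5_def doubleton_eq_iff)
qed

lemma YY5_subset:
  assumes "{u, v} \<in> YY5 S r"
  shows "u \<in> S \<and> v \<in> S"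
  using assms by (auto simp: YY5_def directed_YY5_def doubleton_eq_iff dest: directed_Y5_in)

theorem mainTheorem3:
  fixes t :: real
  assumes "t \<ge> 1"
  shows "\<exists>(S :: complex set) (r :: complex set rel) a b.
           finite S \<and> admissible_ordering S r \<and> a \<in> S \<and> b \<in> S \<and> a \<noteq> b \<and>
           graph_dist (YY5 S r) a b > ereal (t * dist a b)"
proof -
  \<comment> \<open>The factor 2 is a crude bound for the distance of the two left ends.\<close>
  obtain n :: nat where n: "2 * t < real n" using reals_Archimedean2 by blast
  have "finite (rows n)" by (simp add: rows_def)
  then obtain r where adm: "admissible_ordering (rows n) r"
    using exists_admissible_ordering by blast
  have disjoint: "upper n j \<noteq> lower i" if "j \<le> n" for i j
    using height_bounds(1)[OF that] by (auto simp: lower_def upper_def)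
  have "ereal (dist (lower 0) (lower n)) \<le> graph_dist (YY5 (rows n) r) (lower 0) (upper n 0)"
  \<comment> \<open>The set to be left is the lower row, and its only exit is
    \<open>lower n\<close>.\<close>
  proof (rule graph_dist_ge_cut_vertex)
    show "lower 0 \<in> lower ` {..n}" "upper n 0 \<notin> lower ` {..n}"
      using disjoint by auto
    fix u v assume uv: "u \<in> lower ` {..n}" "v \<notin> lower ` {..n}" "{u, v} \<in> YY5 (rows n) r"
    then obtain i j where "u = lower i" "i \<le> n" "v = upper n j" "j \<le> n"
      using YY5_subset[OF uv(3)] by (auto simp: rows_def)
    with crossing_edge_YY5_rows[OF adm] uv(3) show "u = lower n" by blast
  qed
  moreover have "dist (lower 0) (lower n) = real n"
    by (simp add: lower_def dist_complex)
  moreover have "t * dist (lower 0) (upper n 0) < real n"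
  proof -
    have "dist (lower 0) (upper n 0) \<le> 2"
      unfolding lower_def upper_def dist_complex
      by (rule real_le_lsqrt) (auto simp: power2_eq_square)
    then have "t * dist (lower 0) (upper n 0) \<le> t * 2"
      using assms by (intro mult_left_mono) auto
    with n show ?thesis by linarith
  qed
  ultimately have "ereal (t * dist (lower 0) (upper n 0))
      < graph_dist (YY5 (rows n) r) (lower 0) (upper n 0)"
    by (metis ereal_less_le less_ereal.simps(1) order_less_le_trans)
  moreover have "lower 0 \<in> rows n" "upper n 0 \<in> rows n"
    by (auto simp: rows_def)
  moreover have "lower 0 \<noteq> upper n 0" using disjoint[of 0 0] by auto
  ultimately show ?thesis using \<open>finite (rows n)\<close> adm by blast
qed

end
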